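(* Suppose that $\mathcal{I}$ is a discrete valued filtration of a Noetherian ring $R$ and $\alpha\in\mathbb{R}_{>0}$. Then $\mathcal{K}(\mathcal{I}^{(\alpha)}) = \mathcal{I}^{[\alpha]} = \mathcal{K}(\mathcal{I}^{[\alpha]})$.
   Context: Rings are commutative with identity, and $\mathbb{N}$ denotes the nonnegative integers. A filtration of a ring $R$ is a family $\mathcal{I} = \{I_m\}_{m\in\mathbb{N}}$ of ideals of $R$ with $I_0 = R$, $I_n \supseteq I_{n+1}$ and $I_n I_m \subseteq I_{n+m}$ for all $m,n \in \mathbb{N}$. The order of $\mathcal{I}$ is $\nu_{\mathcal{I}}(f) = \sup\{m \mid f \in I_m\} \in \mathbb{N}\cup\{\infty\}$ for $f \in R$. The asymptotic Samuel function of $\mathcal{I}$ is $\overline{\nu}_{\mathcal{I}} : R \to \mathbb{R}_{\ge 0}\cup\{\infty\}$, $\overline{\nu}_{\mathcal{I}}(x) = \lim_{n\to\infty} \nu_{\mathcal{I}}(x^n)/n$ (this limit always exists in $\mathbb{R}_{\ge 0}\cup\{\infty\}$). For any filtration $\mathcal{L}$ of $R$, $\mathcal{K}(\mathcal{L}) = \{K(\mathcal{L})_m\}_{m\in\mathbb{N}}$ is the filtration with $K(\mathcal{L})_m = \{f\in R\mid \overline{\nu}_{\mathcal{L}}(f)\ge m\}$. For $\alpha \in \mathbb{R}_{>0}$, the twist of $\mathcal{I}$ by $\alpha$ is the filtration $\mathcal{I}^{(\alpha)} = \{I_{\lceil \alpha m\rceil}\}_{m\in\mathbb{N}}$. A discrete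 valuation of $R$ is a map $v: R\to\mathbb{Z}\cup\{\infty\}$ obtained as follows: there are a minimal prime $P$ of $R$ and a rank 1 discrete valuation $v$ of the quotient field $\kappa(P)$ of $R/P$, with value group identified with $\mathbb{Z}$ (so $v$ is surjective from $\kappa(P)^{\times}$ onto $\mathbb{Z}$), nonnegative on $R/P$; for $r\in R$ set $v(r)$ to be the value of the image of $r$ in $R/P$ if $r\notin P$, and $v(r)=\infty$ if $r\in P$. For $c\in\mathbb{R}_{\ge0}$, $I(v)_c = \{f\in R\mid v(f)\ge c\}$. A discrete valued filtration of $R$ is a filtration $\mathcal{I}=\{I_m\}_{m\in\mathbb{N}}$ for which there are $s\geq 1$, discrete valuations $v_1,\ldots,v_s$ of $R$ and $a_1,\ldots,a_s\in\mathbb{R}_{>0}$ with $I_m = \bigcap_{i=1}^s I(v_i)_{a_im}$ for all $m\in\mathbb{N}$. For such $\mathcal{I}$ and $\alpha\in\mathbb{R}_{>0}$, $\mathcal{I}^{[\alpha]} = \{I^{[\alpha]}_m\}_{m\in\mathbb{N}}$ is the discrete valued filtration $I^{[\alpha]}_m = \bigcap_{i=1}^s I(v_i)_{\alpha m a_i}$; it is independent of the chosen representation of $\mathcal{I}$. *)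

theory Defs
  imports
    Complex_Main
    "HOL-Library.Extended_Real"
    "HOL-Algebra.QuotRing"
    "HOL-Algebra.Ideal_Product"
    "HOL-Algebra.Ring_Divisibility"
begin

section \<open>The quotient field of a domain\<close>

text \<open>The fraction \<open>a/b\<close> is the set of all pairs \<open>(c, d)\<close> with \<open>d\<close> nonzero and \<open>a d = c b\<close>.\<close>

definition fraction :: "('a, 'b) ring_scheme \<Rightarrow> 'a \<Rightarrow> 'a \<Rightarrow> ('a \<times> 'a) set" where
  "fraction D a b = {(c, d). c \<in> carrier D \<and> d \<in> carrier D - {\<zero>\<^bsub>D\<^esub>} \<and> a \<otimes>\<^bsub>D\<^esub> d = c \<otimes>\<^bsub>D\<^esub> b}"

definition quotient_field :: "('a, 'b) ring_scheme \<Rightarrow> ('a \<times> 'a) set ring" where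
  "quotient_field D =
    \<lparr> carrier = {fraction D a b | a b. a \<in> carrier D \<and> b \<in> carrier D - {\<zero>\<^bsub>D\<^esub>}},
      monoid.mult = (\<lambda>X Y. \<Union>(a, b) \<in> X. \<Union>(c, d) \<in> Y. fraction D (a \<otimes>\<^bsub>D\<^esub> c) (b \<otimes>\<^bsub>D\<^esub> d)),
      one = fraction D \<one>\<^bsub>D\<^esub> \<one>\<^bsub>D\<^esub>,
      zero = fraction D \<zero>\<^bsub>D\<^esub> \<one>\<^bsub>D\<^esub>,
      add = (\<lambda>X Y. \<Union>(a, b) \<in> X. \<Union>(c, d) \<in> Y.
               fraction D (a \<otimes>\<^bsub>D\<^esub> d \<oplus>\<^bsub>D\<^esub> c \<otimes>\<^bsub>D\<^esub> b) (b \<otimes>\<^bsub>D\<^esub> d)) \<rparr>"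

lemma UN_pair_const:
  assumes "p \<in> A" "q \<in> B" and "\<And>x y u v. (x, y) \<in> A \<Longrightarrow> (u, v) \<in> B \<Longrightarrow> F x y u v = Z"
  shows "(\<Union>(x, y) \<in> A. \<Union>(u, v) \<in> B. F x y u v) = Z"
proof -
  have "(\<Union>(x, y) \<in> A. \<Union>(u, v) \<in> B. F x y u v) = (\<Union>x \<in> A. \<Union>u \<in> B. Z)"
    using assms(3) by (intro SUP_cong refl) (auto split: prod.split intro!: SUP_cong)
  then show ?thesis using assms(1,2) by auto
qed

context "domain"
begin

lemma fraction_eq_iff:
  assumes "a \<in> carrier R" "b \<in> carrier R - {\<zero>}" "c \<in> carrier R" "d \<in> carrier R - {\<zero>}"
  shows "fraction R a b = fraction R c d \<longleftrightarrow> a \<otimes> d = c \<otimes> b"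
proof
  assume "fraction R a b = fraction R c d"
  moreover have "(c, d) \<in> fraction R c d" using assms by (auto simp: fraction_def)
  ultimately have "(c, d) \<in> fraction R a b" by simp
  then show "a \<otimes> d = c \<otimes> b" by (auto simp: fraction_def)
next
  have *: "fraction R a b \<subseteq> fraction R c d"
    if e: "a \<otimes> d = c \<otimes> b" and "a \<in> carrier R" "b \<in> carrier R - {\<zero>}"
      "c \<in> carrier R" "d \<in> carrier R - {\<zero>}" for a b c d
  proof clarify
    fix x y assume "(x, y) \<in> fraction R a b"
    then have x: "x \<in> carrier R" and y: "y \<in> carrier R - {\<zero>}" and ay: "a \<otimes> y = x \<otimes> b"
      by (auto simp: fraction_def)
    have "b \<otimes> (c \<otimes> y) = (c \<otimes> b) \<otimes> y" using that x y by (simp add: m_ac)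
    also have "\<dots> = (a \<otimes> y) \<otimes> d" using that x y by (simp add: e[symmetric] m_ac)
    also have "\<dots> = b \<otimes> (x \<otimes> d)" using that x y by (simp add: ay m_ac)
    finally have "c \<otimes> y = x \<otimes> d" using that x y by (subst (asm) m_lcancel) auto
    then show "(x, y) \<in> fraction R c d" using x y by (simp add: fraction_def)
  qed
  assume "a \<otimes> d = c \<otimes> b"
  with *[of a d c b] *[of c b a d] assms show "fraction R a b = fraction R c d" by simp
qed

lemma fraction_mult:
  assumes "a \<in> carrier R" "b \<in> carrier R - {\<zero>}" "c \<in> carrier R" "d \<in> carrier R - {\<zero>}"
  shows "fraction R a b \<otimes>\<^bsub>quotient_field R\<^esub> fraction R c d = fraction R (a \<otimes> c) (b \<otimes> d)"
proof -
  have eq: "fraction R (x \<otimes> u) (y \<otimes> v) = fraction R (a \<otimes> c) (b \<otimes> d)"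
    if "(x, y) \<in> fraction R a b" "(u, v) \<in> fraction R c d" for x y u v
  proof -
    have x: "x \<in> carrier R" "y \<in> carrier R - {\<zero>}" "a \<otimes> y = x \<otimes> b"
      and u: "u \<in> carrier R" "v \<in> carrier R - {\<zero>}" "c \<otimes> v = u \<otimes> d"
      using that by (auto simp: fraction_def)
    have "(x \<otimes> u) \<otimes> (b \<otimes> d) = (x \<otimes> b) \<otimes> (u \<otimes> d)" using x(1,2) u(1,2) assms by (simp add: m_ac)
    also have "\<dots> = (a \<otimes> y) \<otimes> (c \<otimes> v)" by (simp only: x(3) u(3))
    also have "\<dots> = (a \<otimes> c) \<otimes> (y \<otimes> v)" using x(1,2) u(1,2) assms by (simp add: m_ac)
    finally show "fraction R (x \<otimes> u) (y \<otimes> v) = fraction R (a \<otimes> c) (b \<otimes> d)"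
      using x(1,2) u(1,2) assms by (subst fraction_eq_iff) (simp_all add: integral_iff)
  qed
  have "(a, b) \<in> fraction R a b" "(c, d) \<in> fraction R c d" using assms by (auto simp: fraction_def)
  from UN_pair_const[OF this eq] show ?thesis
    by (simp add: quotient_field_def)
qed

lemma fraction_add:
  assumes "a \<in> carrier R" "b \<in> carrier R - {\<zero>}" "c \<in> carrier R" "d \<in> carrier R - {\<zero>}"
  shows "fraction R a b \<oplus>\<^bsub>quotient_field R\<^esub> fraction R c d = fraction R (a \<otimes> d \<oplus> c \<otimes> b) (b \<otimes> d)"
proof -
  have eq: "fraction R (x \<otimes> v \<oplus> u \<otimes> y) (y \<otimes> v) = fraction R (a \<otimes> d \<oplus> c \<otimes> b) (b \<otimes> d)"
    if "(x, y) \<in> fraction R a b" "(u, v) \<in> fraction R c d" for x y u v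
  proof -
    have x: "x \<in> carrier R" "y \<in> carrier R - {\<zero>}" "a \<otimes> y = x \<otimes> b"
      and u: "u \<in> carrier R" "v \<in> carrier R - {\<zero>}" "c \<otimes> v = u \<otimes> d"
      using that by (auto simp: fraction_def)
    have "(x \<otimes> v \<oplus> u \<otimes> y) \<otimes> (b \<otimes> d) = (x \<otimes> b) \<otimes> (v \<otimes> d) \<oplus> (u \<otimes> d) \<otimes> (y \<otimes> b)"
      using x(1,2) u(1,2) assms by (simp add: l_distr r_distr m_ac)
    also have "\<dots> = (a \<otimes> y) \<otimes> (v \<otimes> d) \<oplus> (c \<otimes> v) \<otimes> (y \<otimes> b)" by (simp only: x(3) u(3))
    also have "\<dots> = (a \<otimes> d \<oplus> c \<otimes> b) \<otimes> (y \<otimes> v)" using x(1,2) u(1,2) assms by (simp add: l_distr r_distr m_ac)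
    finally show "fraction R (x \<otimes> v \<oplus> u \<otimes> y) (y \<otimes> v) = fraction R (a \<otimes> d \<oplus> c \<otimes> b) (b \<otimes> d)"
      using x(1,2) u(1,2) assms by (subst fraction_eq_iff) (simp_all add: integral_iff)
  qed
  have "(a, b) \<in> fraction R a b" "(c, d) \<in> fraction R c d" using assms by (auto simp: fraction_def)
  from UN_pair_const[OF this eq] show ?thesis
    by (simp add: quotient_field_def)
qed

lemma fraction_in_quotient_field:
  "a \<in> carrier R \<Longrightarrow> b \<in> carrier R - {\<zero>} \<Longrightarrow> fraction R a b \<in> carrier (quotient_field R)"
  by (auto simp: quotient_field_def)

lemma quotient_fieldE:
  assumes "X \<in> carrier (quotient_field R)"
  obtains a b where "X = fraction R a b" "a \<in> carrier R" "b \<in> carrier R" "b \<noteq> \<zero>"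
  using assms by (auto simp: quotient_field_def)

lemma quotient_field_one: "\<one>\<^bsub>quotient_field R\<^esub> = fraction R \<one> \<one>"
  and quotient_field_zero: "\<zero>\<^bsub>quotient_field R\<^esub> = fraction R \<zero> \<one>"
  by (simp_all add: quotient_field_def)

lemma field_quotient_field: "field (quotient_field R)"
proof -
  note s = fraction_mult fraction_add fraction_eq_iff quotient_field_one quotient_field_zero
    integral_iff l_distr r_distr m_ac a_ac
  interpret Q: cring "quotient_field R"
  proof (rule cringI)
    show "abelian_group (quotient_field R)"
    proof (rule abelian_groupI)
      fix x y assume "x \<in> carrier (quotient_field R)" "y \<in> carrier (quotient_field R)"
      then show "x \<oplus>\<^bsub>quotient_field R\<^esub> y \<in> carrier (quotient_field R)"
        by (elim quotient_fieldE) (auto simp: fraction_add integral_iff intro!: fraction_in_quotient_field)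
    next
      show "\<zero>\<^bsub>quotient_field R\<^esub> \<in> carrier (quotient_field R)"
        by (auto simp: quotient_field_zero intro!: fraction_in_quotient_field)
    next
      fix x y z assume "x \<in> carrier (quotient_field R)" "y \<in> carrier (quotient_field R)"
        "z \<in> carrier (quotient_field R)"
      then show "x \<oplus>\<^bsub>quotient_field R\<^esub> y \<oplus>\<^bsub>quotient_field R\<^esub> z
          = x \<oplus>\<^bsub>quotient_field R\<^esub> (y \<oplus>\<^bsub>quotient_field R\<^esub> z)"
        by (elim quotient_fieldE) (simp add: s)
    next
      fix x y assume "x \<in> carrier (quotient_field R)" "y \<in> carrier (quotient_field R)"
      then show "x \<oplus>\<^bsub>quotient_field R\<^esub> y = y \<oplus>\<^bsub>quotient_field R\<^esub> x"
        by (elim quotient_fieldE) (simp add: s)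
    next
      fix x assume "x \<in> carrier (quotient_field R)"
      then show "\<zero>\<^bsub>quotient_field R\<^esub> \<oplus>\<^bsub>quotient_field R\<^esub> x = x"
        by (elim quotient_fieldE) (simp add: s)
    next
      fix x assume "x \<in> carrier (quotient_field R)"
      then obtain a b where x: "x = fraction R a b" "a \<in> carrier R" "b \<in> carrier R" "b \<noteq> \<zero>"
        by (rule quotient_fieldE)
      then have "fraction R (\<ominus> a) b \<oplus>\<^bsub>quotient_field R\<^esub> x = fraction R (\<ominus> a \<otimes> b \<oplus> a \<otimes> b) (b \<otimes> b)"
        by (simp add: fraction_add)
      also have "\<dots> = \<zero>\<^bsub>quotient_field R\<^esub>"
        using x by (simp add: l_minus l_neg quotient_field_zero fraction_eq_iff integral_iff)
      finally have "fraction R (\<ominus> a) b \<oplus>\<^bsub>quotient_field R\<^esub> x = \<zero>\<^bsub>quotient_field R\<^esub>" .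
      then show "\<exists>y\<in>carrier (quotient_field R). y \<oplus>\<^bsub>quotient_field R\<^esub> x = \<zero>\<^bsub>quotient_field R\<^esub>"
        using x fraction_in_quotient_field[of "\<ominus> a" b] by auto
    qed
    show "comm_monoid (quotient_field R)"
    proof (rule comm_monoidI)
      fix x y assume "x \<in> carrier (quotient_field R)" "y \<in> carrier (quotient_field R)"
      then show "x \<otimes>\<^bsub>quotient_field R\<^esub> y \<in> carrier (quotient_field R)"
        by (elim quotient_fieldE) (auto simp: fraction_mult integral_iff intro!: fraction_in_quotient_field)
    next
      show "\<one>\<^bsub>quotient_field R\<^esub> \<in> carrier (quotient_field R)"
        by (auto simp: quotient_field_one intro!: fraction_in_quotient_field)
    next
      fix x y z assume "x \<in> carrier (quotient_field R)" "y \<in> carrier (quotient_field R)"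
        "z \<in> carrier (quotient_field R)"
      then show "x \<otimes>\<^bsub>quotient_field R\<^esub> y \<otimes>\<^bsub>quotient_field R\<^esub> z
          = x \<otimes>\<^bsub>quotient_field R\<^esub> (y \<otimes>\<^bsub>quotient_field R\<^esub> z)"
        by (elim quotient_fieldE) (simp add: s)
    next
      fix x assume "x \<in> carrier (quotient_field R)"
      then show "\<one>\<^bsub>quotient_field R\<^esub> \<otimes>\<^bsub>quotient_field R\<^esub> x = x"
        by (elim quotient_fieldE) (simp add: s)
    next
      fix x y assume "x \<in> carrier (quotient_field R)" "y \<in> carrier (quotient_field R)"
      then show "x \<otimes>\<^bsub>quotient_field R\<^esub> y = y \<otimes>\<^bsub>quotient_field R\<^esub> x"
        by (elim quotient_fieldE) (simp add: s)
    qed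
    fix x y z assume "x \<in> carrier (quotient_field R)" "y \<in> carrier (quotient_field R)"
      "z \<in> carrier (quotient_field R)"
    then show "(x \<oplus>\<^bsub>quotient_field R\<^esub> y) \<otimes>\<^bsub>quotient_field R\<^esub> z
        = x \<otimes>\<^bsub>quotient_field R\<^esub> z \<oplus>\<^bsub>quotient_field R\<^esub> y \<otimes>\<^bsub>quotient_field R\<^esub> z"
      by (elim quotient_fieldE) (simp add: s)
  qed
  show ?thesis
  proof (rule Q.cring_fieldI2)
    show "\<zero>\<^bsub>quotient_field R\<^esub> \<noteq> \<one>\<^bsub>quotient_field R\<^esub>"
      by (simp add: s)
  next
    fix x assume "x \<in> carrier (quotient_field R)" and nz: "x \<noteq> \<zero>\<^bsub>quotient_field R\<^esub>"
    then obtain a b where x: "x = fraction R a b" "a \<in> carrier R" "b \<in> carrier R" "b \<noteq> \<zero>"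
      by (elim quotient_fieldE)
    with nz have "a \<noteq> \<zero>" by (auto simp: s)
    with x have "x \<otimes>\<^bsub>quotient_field R\<^esub> fraction R b a = \<one>\<^bsub>quotient_field R\<^esub>"
      by (simp add: s)
    then show "\<exists>y\<in>carrier (quotient_field R). x \<otimes>\<^bsub>quotient_field R\<^esub> y = \<one>\<^bsub>quotient_field R\<^esub>"
      using x \<open>a \<noteq> \<zero>\<close> fraction_in_quotient_field[of b a] by auto
  qed
qed

end


section \<open>Discrete valuations of a ring\<close>

text \<open>A rank 1 discrete valuation of a field \<open>K\<close> with value group \<open>\<int>\<close>; the map \<open>w\<close> is only
  meaningful on the nonzero elements of \<open>K\<close>.\<close>

definition rank1_discrete_valuation :: "('k, 'l) ring_scheme \<Rightarrow> ('k \<Rightarrow> int) \<Rightarrow> bool" where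
  "rank1_discrete_valuation K w \<longleftrightarrow>
     (\<forall>x \<in> carrier K - {\<zero>\<^bsub>K\<^esub>}. \<forall>y \<in> carrier K - {\<zero>\<^bsub>K\<^esub>}. w (x \<otimes>\<^bsub>K\<^esub> y) = w x + w y) \<and>
     (\<forall>x \<in> carrier K - {\<zero>\<^bsub>K\<^esub>}. \<forall>y \<in> carrier K - {\<zero>\<^bsub>K\<^esub>}.
        x \<oplus>\<^bsub>K\<^esub> y \<noteq> \<zero>\<^bsub>K\<^esub> \<longrightarrow> min (w x) (w y) \<le> w (x \<oplus>\<^bsub>K\<^esub> y)) \<and>
     w ` (carrier K - {\<zero>\<^bsub>K\<^esub>}) = UNIV"

definition minimal_prime :: "('a, 'b) ring_scheme \<Rightarrow> 'a set \<Rightarrow> bool" where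
  "minimal_prime R P \<longleftrightarrow> primeideal P R \<and> (\<forall>Q. primeideal Q R \<and> Q \<subseteq> P \<longrightarrow> Q = P)"

text \<open>Values in \<open>\<int> \<union> {\<infinity>}\<close> are embedded in the extended reals, so that they can be compared with
  real numbers. Elements of \<open>R/P\<close> are viewed as fractions with denominator one.\<close>

definition discrete_valuation :: "('a, 'b) ring_scheme \<Rightarrow> ('a \<Rightarrow> ereal) \<Rightarrow> bool" where
  "discrete_valuation R v \<longleftrightarrow>
     (\<exists>P w. minimal_prime R P \<and>
        rank1_discrete_valuation (quotient_field (R Quot P)) w \<and>
        (\<forall>x \<in> carrier (R Quot P) - {\<zero>\<^bsub>R Quot P\<^esub>}. 0 \<le> w (fraction (R Quot P) x \<one>\<^bsub>R Quot P\<^esub>)) \<and>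
        (\<forall>r \<in> carrier R.
           v r = (if r \<in> P then \<infinity>
                  else ereal (of_int (w (fraction (R Quot P) (P +>\<^bsub>R\<^esub> r) \<one>\<^bsub>R Quot P\<^esub>))))))"

definition valuation_ideal :: "('a, 'b) ring_scheme \<Rightarrow> ('a \<Rightarrow> ereal) \<Rightarrow> real \<Rightarrow> 'a set" where
  "valuation_ideal R v c = {f \<in> carrier R. v f \<ge> ereal c}"


section \<open>Filtrations\<close>

definition filtration :: "('a, 'b) ring_scheme \<Rightarrow> (nat \<Rightarrow> 'a set) \<Rightarrow> bool" where
  "filtration R I \<longleftrightarrow>
     (\<forall>m. ideal (I m) R) \<and> I 0 = carrier R \<and> (\<forall>n. I (Suc n) \<subseteq> I n) \<and>
     (\<forall>m n. I n \<cdot>\<^bsub>R\<^esub> I m \<subseteq> I (n + m))"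

definition filtration_order :: "(nat \<Rightarrow> 'a set) \<Rightarrow> 'a \<Rightarrow> enat" where
  "filtration_order I f = Sup {enat m | m. f \<in> I m}"

text \<open>The limit always exists in the extended reals when \<open>I\<close> is a filtration; the term for \<open>n = 0\<close>
  (a division by zero) does not affect it.\<close>

definition asymptotic_samuel :: "('a, 'b) ring_scheme \<Rightarrow> (nat \<Rightarrow> 'a set) \<Rightarrow> 'a \<Rightarrow> ereal" where
  "asymptotic_samuel R I x =
     lim (\<lambda>n. ereal_of_enat (filtration_order I (x [^]\<^bsub>R\<^esub> n)) / ereal (real n))"

definition filtration_K :: "('a, 'b) ring_scheme \<Rightarrow> (nat \<Rightarrow> 'a set) \<Rightarrow> nat \<Rightarrow> 'a set" where
  "filtration_K R L m = {f \<in> carrier R. asymptotic_samuel R L f \<ge> ereal (real m)}"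

definition filtration_twist :: "(nat \<Rightarrow> 'a set) \<Rightarrow> real \<Rightarrow> nat \<Rightarrow> 'a set" where
  "filtration_twist I \<alpha> m = I (nat \<lceil>\<alpha> * real m\<rceil>)"

text \<open>The valuations \<open>v\<^sub>1, \<dots>, v\<^sub>s\<close> and the real numbers \<open>a\<^sub>1, \<dots>, a\<^sub>s\<close> are indexed by \<open>{..<s}\<close>.\<close>

definition dvf_representation ::
    "('a, 'b) ring_scheme \<Rightarrow> nat \<Rightarrow> (nat \<Rightarrow> 'a \<Rightarrow> ereal) \<Rightarrow> (nat \<Rightarrow> real) \<Rightarrow> (nat \<Rightarrow> 'a set) \<Rightarrow> bool" where
  "dvf_representation R s v a I \<longleftrightarrow>
     s \<ge> 1 \<and> (\<forall>i<s. discrete_valuation R (v i)) \<and> (\<forall>i<s. a i > 0) \<and>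
     (\<forall>m. I m = (\<Inter>i<s. valuation_ideal R (v i) (a i * real m)))"

definition discrete_valued_filtration :: "('a, 'b) ring_scheme \<Rightarrow> (nat \<Rightarrow> 'a set) \<Rightarrow> bool" where
  "discrete_valued_filtration R I \<longleftrightarrow> filtration R I \<and> (\<exists>s v a. dvf_representation R s v a I)"

text \<open>The filtration \<open>I\<^sup>[\<^sup>\<alpha>\<^sup>]\<close>, computed from a representation of \<open>I\<close> by valuations \<open>v i\<close> and
  real numbers \<open>a i\<close>.\<close>

definition dvf_bracket ::
    "('a, 'b) ring_scheme \<Rightarrow> nat \<Rightarrow> (nat \<Rightarrow> 'a \<Rightarrow> ereal) \<Rightarrow> (nat \<Rightarrow> real) \<Rightarrow> real \<Rightarrow> nat \<Rightarrow> 'a set" where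
  "dvf_bracket R s v a \<alpha> m = (\<Inter>i<s. valuation_ideal R (v i) (\<alpha> * real m * a i))"

end

theory Submission
  imports Defs
begin

text \<open>Put \<open>\<mu>(f) = min\<^sub>i v\<^sub>i(f) / a\<^sub>i\<close>. Membership of \<open>f\<close> in the \<open>m\<close>-th ideal of the twisted
  filtration means \<open>\<lceil>\<alpha> m\<rceil> \<le> \<mu>(f)\<close>, and for the bracket filtration it means \<open>\<alpha> m \<le> \<mu>(f)\<close>; in both
  cases the order of \<open>f\<close> differs from \<open>\<mu>(f) / \<alpha>\<close> by a bounded amount. Since \<open>\<mu>(f\<^sup>n) = n \<mu>(f)\<close>, the
  asymptotic Samuel function of either filtration is \<open>\<mu> / \<alpha>\<close>, which is at least \<open>m\<close> exactly on
  the \<open>m\<close>-th ideal of the bracket filtration.\<close>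

text \<open>Elements of \<open>P\<close> have value \<infinity>; any other element has a nonzero
  coset, where nonnegativity of \<open>w\<close> applies.\<close>

lemma discrete_valuation_nonneg:
  assumes "cring R" "discrete_valuation R v" "r \<in> carrier R"
  shows "0 \<le> v r"
proof -
  interpret cring R by fact
  obtain P w where P: "minimal_prime R P"
    and nn: "\<And>x. x \<in> carrier (R Quot P) - {\<zero>\<^bsub>R Quot P\<^esub>} \<Longrightarrow>
          0 \<le> w (fraction (R Quot P) x \<one>\<^bsub>R Quot P\<^esub>)"
    and v: "\<And>r. r \<in> carrier R \<Longrightarrow> v r = (if r \<in> P then \<infinity>
             else ereal (of_int (w (fraction (R Quot P) (P +>\<^bsub>R\<^esub> r) \<one>\<^bsub>R Quot P\<^esub>))))"
    using assms(2) unfolding discrete_valuation_def by blast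
  interpret P: primeideal P R using P by (simp add: minimal_prime_def)
  have "P +>\<^bsub>R\<^esub> r \<in> carrier (R Quot P) - {\<zero>\<^bsub>R Quot P\<^esub>}" if "r \<notin> P"
    using that assms(3) P.rcos_const_imp_mem[of r]
    by (auto simp: FactRing_def A_RCOSETS_def')
  then show ?thesis using nn v assms(3) by auto
qed

text \<open>If a factor lies in \<open>P\<close>, so does the product, and both sides are
  \<infinity> because no value is -\<infinity>. Otherwise primality keeps the product outside
  \<open>P\<close>, and multiplicativity of \<open>w\<close> transfers through fractions with
  denominator one.\<close>

lemma discrete_valuation_mult:
  assumes "cring R" "discrete_valuation R v" "r \<in> carrier R" "t \<in> carrier R"
  shows "v (r \<otimes>\<^bsub>R\<^esub> t) = v r + v t"
proof -
  interpret cring R by fact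
  obtain P w where P: "minimal_prime R P"
    and w: "rank1_discrete_valuation (quotient_field (R Quot P)) w"
    and v: "\<And>r. r \<in> carrier R \<Longrightarrow> v r = (if r \<in> P then \<infinity>
             else ereal (of_int (w (fraction (R Quot P) (P +>\<^bsub>R\<^esub> r) \<one>\<^bsub>R Quot P\<^esub>))))"
    using assms(2) unfolding discrete_valuation_def by blast
  interpret P: primeideal P R using P by (simp add: minimal_prime_def)
  interpret D: "domain" "R Quot P" by (rule P.quotient_is_domain)
  let ?f = "\<lambda>r. fraction (R Quot P) (P +>\<^bsub>R\<^esub> r) \<one>\<^bsub>R Quot P\<^esub>"
  show ?thesis
  proof (cases "r \<in> P \<or> t \<in> P")
    case True
    then have "r \<otimes>\<^bsub>R\<^esub> t \<in> P" using assms(3,4) P.I_l_closed P.I_r_closed by blast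
    then show ?thesis
      using True assms(3,4) by (auto simp: v)
  next
    case False
    then have rt: "r \<otimes>\<^bsub>R\<^esub> t \<notin> P" using P.I_prime assms(3,4) by blast
    have c: "P +>\<^bsub>R\<^esub> x \<in> carrier (R Quot P)" if "x \<in> carrier R" for x
      using that by (auto simp: FactRing_def A_RCOSETS_def')
    have nz: "P +>\<^bsub>R\<^esub> x \<noteq> \<zero>\<^bsub>R Quot P\<^esub>" if "x \<in> carrier R" "x \<notin> P" for x
      using that P.rcos_const_imp_mem[of x] by (auto simp: FactRing_def)
    \<comment> \<open>The axioms for \<open>w\<close> speak of nonzero field elements only.\<close>
    have q: "?f x \<in> carrier (quotient_field (R Quot P)) - {\<zero>\<^bsub>quotient_field (R Quot P)\<^esub>}"
      if "x \<in> carrier R" "x \<notin> P" for x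
    proof -
      have "?f x \<noteq> \<zero>\<^bsub>quotient_field (R Quot P)\<^esub>"
        unfolding D.quotient_field_zero using c[OF that(1)] nz[OF that]
        by (subst D.fraction_eq_iff) simp_all
      moreover have "?f x \<in> carrier (quotient_field (R Quot P))"
        using c[OF that(1)] by (intro D.fraction_in_quotient_field) simp_all
      ultimately show ?thesis by blast
    qed
    have "?f r \<otimes>\<^bsub>quotient_field (R Quot P)\<^esub> ?f t = ?f (r \<otimes>\<^bsub>R\<^esub> t)"
      using c assms(3,4)
      by (simp add: D.fraction_mult) (simp add: FactRing_def P.rcoset_mult_add)
    moreover have "w (?f r \<otimes>\<^bsub>quotient_field (R Quot P)\<^esub> ?f t) = w (?f r) + w (?f t)"
      using w[unfolded rank1_discrete_valuation_def, THEN conjunct1] q[of r] q[of t] False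
        assms(3,4) by (auto simp only: de_Morgan_disj)
    ultimately show ?thesis using False rt assms(3,4) by (simp add: v)
  qed
qed

lemma discrete_valuation_pow:
  assumes "cring R" "discrete_valuation R v" "x \<in> carrier R" "n > 0"
  shows "v (x [^]\<^bsub>R\<^esub> n) = ereal (real n) * v x"
  using assms(4)
proof (induction n rule: nat_induct_non_zero)
  interpret cring R by fact
  {
    case 1
    then show ?case using assms(3) by simp
  next
    case (Suc n)
    have "v (x [^]\<^bsub>R\<^esub> Suc n) = ereal (real n) * v x + v x"
      using Suc assms by (simp add: discrete_valuation_mult)
    also have "\<dots> = ereal (real (Suc n)) * v x"
      using discrete_valuation_nonneg[OF assms(1-3)]
      by (cases "v x") (auto simp: algebra_simps)
    finally show ?case .
  }
qed

text \<open>The two hypotheses trap the order of the \<open>n\<close>-th power of \<open>x\<close>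
  within a bounded distance of \<open>n * M / \<alpha>\<close>, and dividing by \<open>n\<close>
  removes the error. The slack \<open>+ 1\<close> in \<open>lower\<close> leaves room for the
  ceiling in the twist.\<close>

lemma asymptotic_samuel_eqI:
  assumes M: "0 \<le> M" and \<alpha>: "\<alpha> > 0"
    and upper: "\<And>n m. n > 0 \<Longrightarrow> x [^]\<^bsub>R\<^esub> n \<in> L m \<Longrightarrow> ereal (\<alpha> * real m) \<le> ereal (real n) * M"
    and lower: "\<And>n m. n > 0 \<Longrightarrow> ereal (\<alpha> * real m + 1) \<le> ereal (real n) * M \<Longrightarrow> x [^]\<^bsub>R\<^esub> n \<in> L m"
  shows "asymptotic_samuel R L x = M / ereal \<alpha>"
proof -
  define q where "q n = ereal_of_enat (filtration_order L (x [^]\<^bsub>R\<^esub> n)) / ereal (real n)"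
    for n :: nat
  have "q \<longlonglongrightarrow> M / ereal \<alpha>"
  proof (cases M)
    case PInf
    \<comment> \<open>Here \<open>lower\<close> holds for every \<open>m\<close>, so the order is
      the supremum of all natural numbers.\<close>
    have "q n = \<infinity>" if "n > 0" for n
    proof -
      have "x [^]\<^bsub>R\<^esub> n \<in> L m" for m using lower[of n m] that PInf by simp
      then have "filtration_order L (x [^]\<^bsub>R\<^esub> n) = Sup (range enat)"
        by (simp add: filtration_order_def full_SetCompr_eq)
      also have "\<dots> = \<infinity>"
        using range_inj_infinite[of enat] by (simp add: Sup_enat_def inj_on_def)
      finally show ?thesis using that by (simp add: q_def)
    qed
    then have "eventually (\<lambda>n. q n = M / ereal \<alpha>) sequentially"
      using PInf \<alpha> by (intro eventually_sequentiallyI[of 1]) auto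
    then show ?thesis by (rule tendsto_eventually)
  next
    case (real r)
    \<comment> \<open>The error \<open>1 / \<alpha>\<close> comes from the slack in
      \<open>lower\<close>, the further \<open>1\<close> from rounding down to a natural number;
      both are then divided by \<open>n\<close>.\<close>
    have bounds: "ereal (r / \<alpha> - (1 / \<alpha> + 1) / real n) \<le> q n" "q n \<le> ereal (r / \<alpha>)"
      if n: "n > 0" for n
    proof -
      define S where "S = {m. x [^]\<^bsub>R\<^esub> n \<in> L m}"
      have order: "filtration_order L (x [^]\<^bsub>R\<^esub> n) = (SUP m\<in>S. enat m)"
        by (simp add: filtration_order_def S_def setcompr_eq_image)
      have le: "real m \<le> real n * r / \<alpha>" if "m \<in> S" for m
        using upper[OF n, of m] that \<alpha> real by (simp add: S_def field_simps)
      \<comment> \<open>A finite upper bound comes first: it shows that the order is a natural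
        number \<open>k\<close>.\<close>
      have "filtration_order L (x [^]\<^bsub>R\<^esub> n) \<le> enat (nat \<lfloor>real n * r / \<alpha>\<rfloor>)"
        unfolding order
        by (intro SUP_least) (use le in \<open>auto intro: le_nat_floor\<close>)
      then obtain k where k: "filtration_order L (x [^]\<^bsub>R\<^esub> n) = enat k"
        and "k \<le> nat \<lfloor>real n * r / \<alpha>\<rfloor>"
        by (cases "filtration_order L (x [^]\<^bsub>R\<^esub> n)") auto
      moreover have "0 \<le> real n * r / \<alpha>" using M real \<alpha> by simp
      ultimately have ub: "real k \<le> real n * r / \<alpha>" by linarith
      have lb: "(real n * r - 1) / \<alpha> - 1 \<le> real k"
      \<comment> \<open>In the negative case the bound is trivial since \<open>k\<close> is
        nonnegative; otherwise the floor is the largest index that \<open>lower\<close>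
        provides.\<close>
      proof (cases "(real n * r - 1) / \<alpha> < 0")
        case False
        define m where "m = nat \<lfloor>(real n * r - 1) / \<alpha>\<rfloor>"
        have m: "real m \<le> (real n * r - 1) / \<alpha>" "(real n * r - 1) / \<alpha> - 1 \<le> real m"
          using False unfolding m_def by linarith+
        have "m \<in> S" using lower[OF n, of m] m(1) \<alpha> real by (simp add: S_def field_simps)
        then have "enat m \<le> enat k" unfolding k[symmetric] order by (rule SUP_upper)
        then show ?thesis using m(2) by simp
      qed simp
      have qn: "q n = ereal (real k / real n)" using n by (simp add: q_def k)
      show "q n \<le> ereal (r / \<alpha>)" using ub n \<alpha> by (simp add: qn field_simps)
      have "r / \<alpha> - (1 / \<alpha> + 1) / real n = ((real n * r - 1) / \<alpha> - 1) / real n"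
        using n \<alpha> by (simp add: field_simps)
      also have "\<dots> \<le> real k / real n" using lb by (rule divide_right_mono) simp
      finally show "ereal (r / \<alpha> - (1 / \<alpha> + 1) / real n) \<le> q n" by (simp add: qn)
    qed
    have "(\<lambda>n. r / \<alpha> - (1 / \<alpha> + 1) / real n) \<longlonglongrightarrow> r / \<alpha> - 0"
      by (intro tendsto_intros lim_const_over_n)
    then have lim: "(\<lambda>n. ereal (r / \<alpha> - (1 / \<alpha> + 1) / real n)) \<longlonglongrightarrow> ereal (r / \<alpha>)"
      by simp
    have "q \<longlonglongrightarrow> ereal (r / \<alpha>)"
    proof (rule tendsto_sandwich[OF _ _ lim tendsto_const])
      show "\<forall>\<^sub>F n in sequentially. ereal (r / \<alpha> - (1 / \<alpha> + 1) / real n) \<le> q n"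
        "\<forall>\<^sub>F n in sequentially. q n \<le> ereal (r / \<alpha>)"
        using bounds by (auto intro!: eventually_sequentiallyI[of 1])
    qed
    then show ?thesis using real \<alpha> by simp
  qed (use M in simp)
  then show ?thesis by (simp add: asymptotic_samuel_def q_def[abs_def] limI)
qed

theorem proposition1p7:
  fixes R (structure) and I :: "nat \<Rightarrow> 'a set"
    and s :: nat and v :: "nat \<Rightarrow> 'a \<Rightarrow> ereal" and a :: "nat \<Rightarrow> real" and \<alpha> :: real
  assumes "cring R" and "noetherian_ring R"
    and "discrete_valued_filtration R I"
    and "dvf_representation R s v a I"
    and "\<alpha> > 0"
  shows "filtration_K R (filtration_twist I \<alpha>) = dvf_bracket R s v a \<alpha>
       \<and> dvf_bracket R s v a \<alpha> = filtration_K R (dvf_bracket R s v a \<alpha>)"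
proof -
  interpret cring R by fact
  have s: "s \<ge> 1" and v: "\<And>i. i < s \<Longrightarrow> discrete_valuation R (v i)"
    and a: "\<And>i. i < s \<Longrightarrow> a i > 0"
    and I: "\<And>m. I m = (\<Inter>i<s. valuation_ideal R (v i) (a i * real m))"
    using assms(4) by (auto simp: dvf_representation_def)
  define \<mu> where "\<mu> x = (INF i\<in>{..<s}. v i x / ereal (a i))" for x
  have le_\<mu>: "ereal c \<le> \<mu> x \<longleftrightarrow> (\<forall>i<s. ereal (a i * c) \<le> v i x)" for c x
    unfolding \<mu>_def le_INF_iff using a by (auto simp: ereal_le_divide_pos)
  \<comment> \<open>This is homogeneity of \<mu> on powers, phrased through real lower bounds
    \<open>c\<close>, so that each \<open>v i\<close> can be treated separately and no infimum has
    to be rescaled.\<close>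
  have le_\<mu>_pow: "ereal c \<le> ereal (real n) * \<mu> x \<longleftrightarrow> ereal c \<le> \<mu> (x [^] n)"
    if x: "x \<in> carrier R" and n: "n > 0" for c x and n :: nat
  proof -
    have "ereal c \<le> ereal (real n) * \<mu> x \<longleftrightarrow> ereal (c / real n) \<le> \<mu> x"
      using n by (cases "\<mu> x") (auto simp: field_simps)
    also have "\<dots> \<longleftrightarrow> (\<forall>i<s. ereal (a i * c) \<le> ereal (real n) * v i x)"
      unfolding le_\<mu>
    proof (intro all_cong)
      fix i
      show "ereal (a i * (c / real n)) \<le> v i x \<longleftrightarrow> ereal (a i * c) \<le> ereal (real n) * v i x"
        using n by (cases "v i x") (auto simp: field_simps)
    qed
    also have "\<dots> \<longleftrightarrow> ereal c \<le> \<mu> (x [^] n)"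
      unfolding le_\<mu> using discrete_valuation_pow[OF assms(1) v x n] by auto
    finally show ?thesis .
  qed
  have \<mu>_nonneg: "0 \<le> \<mu> x" if "x \<in> carrier R" for x
    using le_\<mu>[of 0 x] discrete_valuation_nonneg[OF assms(1) v that] by (simp add: zero_ereal_def)
  have mem_I: "x \<in> I m \<longleftrightarrow> ereal (real m) \<le> \<mu> x" if "x \<in> carrier R" for x m
    using that s by (auto simp: I le_\<mu> valuation_ideal_def)
  have mem_bracket: "x \<in> dvf_bracket R s v a \<alpha> m \<longleftrightarrow> ereal (\<alpha> * real m) \<le> \<mu> x"
    if "x \<in> carrier R" for x m
    using that s by (auto simp: dvf_bracket_def le_\<mu> valuation_ideal_def mult_ac)
  \<comment> \<open>Some index must exist: an intersection over the empty family would be the whole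
    type.\<close>
  have bracket_carrier: "dvf_bracket R s v a \<alpha> m \<subseteq> carrier R" for m
  proof -
    have "0 \<in> {..<s}" using s by simp
    then show ?thesis unfolding dvf_bracket_def valuation_ideal_def by blast
  qed
  have bracket: "asymptotic_samuel R (dvf_bracket R s v a \<alpha>) x = \<mu> x / ereal \<alpha>"
    if x: "x \<in> carrier R" for x
  proof (rule asymptotic_samuel_eqI)
    fix n m :: nat assume n: "n > 0"
    show "ereal (\<alpha> * real m) \<le> ereal (real n) * \<mu> x" if "x [^] n \<in> dvf_bracket R s v a \<alpha> m"
      using that x n by (simp add: le_\<mu>_pow mem_bracket)
    show "x [^] n \<in> dvf_bracket R s v a \<alpha> m" if "ereal (\<alpha> * real m + 1) \<le> ereal (real n) * \<mu> x"
    proof -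
      have "ereal (\<alpha> * real m) \<le> ereal (\<alpha> * real m + 1)" by simp
      then show ?thesis using that
        unfolding mem_bracket[OF nat_pow_closed[OF x]] le_\<mu>_pow[OF x n] by (rule order_trans)
    qed
  qed (use x \<mu>_nonneg assms(5) in auto)
  have twist: "asymptotic_samuel R (filtration_twist I \<alpha>) x = \<mu> x / ereal \<alpha>"
    if x: "x \<in> carrier R" for x
  proof (rule asymptotic_samuel_eqI)
    fix n m :: nat assume n: "n > 0"
    have "0 \<le> \<alpha> * real m" using assms(5) by simp
    \<comment> \<open>The first bound serves the upper hypothesis of
      \<open>asymptotic_samuel_eqI\<close>; in the second, the rounding loss is absorbed by the
      slack of the lower one.\<close>
    then have ceil: "\<alpha> * real m \<le> real (nat \<lceil>\<alpha> * real m\<rceil>)"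
      "real (nat \<lceil>\<alpha> * real m\<rceil>) \<le> \<alpha> * real m + 1" by linarith+
    show "ereal (\<alpha> * real m) \<le> ereal (real n) * \<mu> x" if "x [^] n \<in> filtration_twist I \<alpha> m"
      using that x ceil(1) unfolding filtration_twist_def mem_I[OF nat_pow_closed[OF x]]
        le_\<mu>_pow[OF x n] by (metis ereal_less_eq(3) order_trans)
    show "x [^] n \<in> filtration_twist I \<alpha> m" if "ereal (\<alpha> * real m + 1) \<le> ereal (real n) * \<mu> x"
      using that x ceil(2) unfolding filtration_twist_def mem_I[OF nat_pow_closed[OF x]]
        le_\<mu>_pow[OF x n] by (metis ereal_less_eq(3) order_trans)
  qed (use x \<mu>_nonneg assms(5) in auto)
  have "ereal (real m) \<le> \<mu> x / ereal \<alpha> \<longleftrightarrow> ereal (\<alpha> * real m) \<le> \<mu> x" for m x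
    using assms(5) by (simp add: ereal_le_divide_pos)
  \<comment> \<open>Only the asymptotic function of \<open>L\<close> enters, so both equalities
    follow from this one fact, with \<open>L\<close> the twist and then the bracket
    filtration.\<close>
  then have "filtration_K R L m = dvf_bracket R s v a \<alpha> m"
    if "\<And>x. x \<in> carrier R \<Longrightarrow> asymptotic_samuel R L x = \<mu> x / ereal \<alpha>" for L m
    using that mem_bracket bracket_carrier[of m] by (auto simp: filtration_K_def)
  with bracket twist show ?thesis by (auto simp: fun_eq_iff)
qed

end
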